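(* Let $\ell \geq 2$ be an integer, and let $A$ be an infinite set of nonnegative integers. If $r_{A,2}(n) \geq \ell$ for all sufficiently large integers $n \in 2A$, then there is a positive number $w_0$ such that \[ A(x) > \frac{(\ell - 1)\log x}{\log 2} - w_0 \] for all $x \geq 2$.
   Context: For a set $A$ of integers, the counting function $A(x)$ is the number of positive integers $a \in A$ with $a \leq x$. The sumset $2A$ is the set of all integers of the form $a_1 + a_2$ with $a_1, a_2 \in A$ (not necessarily distinct). For every integer $n$, the representation function $r_{A,2}(n)$ is the number of pairs $(a_1,a_2) \in A^2$ with $a_1 \leq a_2$ and $a_1 + a_2 = n$. *)

theory Defs
  imports Complex_Main
begin

(* Only positive elements are counted, so a possible element 0 does not contribute. *)
definition counting_fun :: "int set \<Rightarrow> real \<Rightarrow> nat" where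
  "counting_fun A x = card {a \<in> A. 0 < a \<and> real_of_int a \<le> x}"

definition sumset2 :: "int set \<Rightarrow> int set" where
  "sumset2 A = {a1 + a2 | a1 a2. a1 \<in> A \<and> a2 \<in> A}"

(* For A bounded below the set of pairs is finite, so card is the true number of
   representations; for other A with infinitely many representations of n the value is 0. *)
definition rep2 :: "int set \<Rightarrow> int \<Rightarrow> nat" where
  "rep2 A n = card {(a1, a2). a1 \<in> A \<and> a2 \<in> A \<and> a1 \<le> a2 \<and> a1 + a2 = n}"

end

(* If a is a large element of A, then 2a = a + a has at least l - 1 representations other than
   (a, a), and the larger summands of these are distinct elements of A in (a, 2a].
   Passing to the largest element of A in (a, 2a] and iterating gives j (l - 1) elements of A
   in (a, 2^j a], and j can be taken about as large as log x / log 2. *)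
theory Submission
  imports Defs
begin

lemma card_between_double:
  fixes A :: "int set"
  assumes nonneg: "\<forall>a\<in>A. a \<ge> 0" and a: "a \<in> A" and rep: "rep2 A (2 * a) \<ge> l"
  shows "card (A \<inter> {a<..2 * a}) \<ge> l - 1"
proof -
  let ?R = "{(a1, a2). a1 \<in> A \<and> a2 \<in> A \<and> a1 \<le> a2 \<and> a1 + a2 = 2 * a}"
  have "card (?R - {(a, a)}) \<le> card (A \<inter> {a<..2 * a})"
  proof (rule card_inj_on_le)
    show "inj_on snd (?R - {(a, a)})"
      by (auto simp: inj_on_def)
    \<comment> \<open>With (a, a) removed, the larger summand exceeds \<open>a\<close>; it is at
      most \<open>2 * a\<close> because the smaller one is nonnegative.\<close>
    show "snd ` (?R - {(a, a)}) \<subseteq> A \<inter> {a<..2 * a}"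
      using nonneg by force
  qed simp
  moreover have "card (?R - {(a, a)}) = card ?R - 1"
    using a by (simp add: card_Diff_singleton)
  ultimately show ?thesis
    using rep unfolding rep2_def by linarith
qed

text \<open>Induction on \<open>j\<close> with \<open>a\<close> arbitrary: the interval up to
  \<open>2 * a\<close> supplies \<open>m\<close> elements, and the induction hypothesis is applied
  to the largest of them.\<close>

lemma card_between_power_two:
  fixes A :: "int set"
  assumes double: "\<And>a. a \<in> A \<Longrightarrow> a \<ge> N \<Longrightarrow> card (A \<inter> {a<..2 * a}) \<ge> m"
    and "m > 0" "a \<in> A" "a \<ge> N" "a \<ge> 0"
  shows "card (A \<inter> {a<..2 ^ j * a}) \<ge> j * m"
  using assms(3-)
proof (induction j arbitrary: a)
  case 0
  then show ?case by simp
next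
  case (Suc j)
  let ?T = "A \<inter> {a<..2 * a}"
  have card_T: "card ?T \<ge> m"
    using double Suc.prems by blast
  then have ne: "?T \<noteq> {}"
    using \<open>m > 0\<close> by (metis card.empty not_le)
  \<comment> \<open>Maximality puts every element of \<open>?U\<close> beyond all of
    \<open>?T\<close>, so the two counts add. Since \<open>b\<close> is at most
    \<open>2 * a\<close>, the restart costs only one doubling.\<close>
  define b where "b = Max ?T"
  have b: "b \<in> A" "a < b" "b \<le> 2 * a"
    using Max_in[OF _ ne] by (auto simp: b_def)
  have T_le: "t \<le> b" if "t \<in> ?T" for t
    using that by (simp add: b_def)
  let ?U = "A \<inter> {b<..2 ^ j * b}"
  have card_U: "card ?U \<ge> j * m"
    using Suc.IH b Suc.prems by simp
  define c where "c = 2 ^ Suc j * a"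
  have "2 * a \<le> c"
    using Suc.prems by (simp add: c_def mult_le_cancel_right1)
  moreover have "2 ^ j * b \<le> c"
    using b by (simp add: c_def)
  ultimately have "?T \<union> ?U \<subseteq> A \<inter> {a<..c}"
    using b by auto
  then have "card (?T \<union> ?U) \<le> card (A \<inter> {a<..c})"
    by (intro card_mono) auto
  moreover have "card (?T \<union> ?U) = card ?T + card ?U"
    using T_le by (intro card_Un_disjoint) force+
  ultimately show ?case
    using card_T card_U by (simp add: c_def)
qed

theorem theorem2:
  fixes l :: nat and A :: "int set"
  assumes "l \<ge> 2"
    and "infinite A"
    and "\<forall>a\<in>A. a \<ge> 0"
    and "\<forall>\<^sub>F n in at_top. n \<in> sumset2 A \<longrightarrow> rep2 A n \<ge> l"
  shows "\<exists>w0::real. w0 > 0 \<and>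
    (\<forall>x::real. x \<ge> 2 \<longrightarrow>
      real (counting_fun A x) > (real l - 1) * ln x / ln 2 - w0)"
proof -
  obtain N where N: "\<And>n. n \<ge> N \<Longrightarrow> n \<in> sumset2 A \<Longrightarrow> rep2 A n \<ge> l"
    using assms(4) unfolding eventually_at_top_linorder by blast
  \<comment> \<open>For \<open>a\<close> at least \<open>M\<close>, positivity gives
    \<open>2 * a \<ge> a \<ge> N\<close>, so the hypothesis applies to \<open>2 * a\<close>; it also
    makes the logarithm \<open>L\<close> below nonnegative.\<close>
  define M where "M = max N 1"
  have double: "card (A \<inter> {a<..2 * a}) \<ge> l - 1" if "a \<in> A" "a \<ge> M" for a
  proof (rule card_between_double[OF assms(3) that(1)])
    have "2 * a \<in> sumset2 A"
      using that(1) unfolding sumset2_def by (auto intro!: exI[of _ a])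
    then show "rep2 A (2 * a) \<ge> l"
      using N that(2) unfolding M_def by simp
  qed
  have "\<not> A \<subseteq> {0..M}"
    using assms(2) finite_subset by blast
  then obtain a where a: "a \<in> A" "a \<ge> M"
    using assms(3) by force
  have a1: "a \<ge> 1"
    using a(2) unfolding M_def by simp
  define L where "L = log 2 (real_of_int a)"
  have "L \<ge> 0"
    using a1 unfolding L_def by simp
  have pos: "real l - 1 > 0"
    using assms(1) by simp
  \<comment> \<open>The term \<open>L\<close> pays for starting the doublings at \<open>a\<close>
    instead of 1, and the 1 pays for rounding their number down to an integer.\<close>
  define w0 where "w0 = (real l - 1) * (L + 1)"
  have "w0 > 0"
    using pos \<open>L \<ge> 0\<close> unfolding w0_def by simp
  moreover have "real (counting_fun A x) > (real l - 1) * ln x / ln 2 - w0"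
    if x: "x \<ge> 2" for x
  proof -
    have eq: "(real l - 1) * ln x / ln 2 - w0 = (real l - 1) * (log 2 x - L - 1)"
      unfolding w0_def log_def by (simp add: algebra_simps)
    show ?thesis
    proof (cases "x \<ge> a")
      case True
      \<comment> \<open>This is the largest \<open>j\<close> with \<open>2 ^ j * a \<le> x\<close>.
        The floor loses strictly less than 1, which yields the strict inequality of the
        conclusion.\<close>
      define j where "j = nat \<lfloor>log 2 x - L\<rfloor>"
      have ge: "log 2 x - L \<ge> 0"
        unfolding L_def using True a1 by simp
      then have j: "real j \<le> log 2 x - L" "log 2 x - L - 1 < real j"
        unfolding j_def by linarith+
      have "2 ^ j * real_of_int a = 2 powr (real j + L)"
        using a1 by (simp add: L_def powr_add powr_realpow)
      also have "\<dots> \<le> 2 powr (log 2 x)"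
        using j(1) by simp
      also have "\<dots> = x"
        using x by simp
      finally have le: "2 ^ j * real_of_int a \<le> x" .
      have "real_of_int b \<le> x" if "b \<le> 2 ^ j * a" for b
      proof -
        have "real_of_int b \<le> real_of_int (2 ^ j * a)"
          using that by (simp only: of_int_le_iff)
        then show ?thesis
          using le by simp
      qed
      then have "A \<inter> {a<..2 ^ j * a} \<subseteq> {b \<in> A. 0 < b \<and> real_of_int b \<le> x}"
        using a1 by auto
      moreover have "finite {b \<in> A. 0 < b \<and> real_of_int b \<le> x}"
        by (rule finite_subset[of _ "{0..\<lfloor>x\<rfloor>}"]) (auto simp: le_floor_iff)
      ultimately have "card (A \<inter> {a<..2 ^ j * a}) \<le> counting_fun A x"
        unfolding counting_fun_def by (intro card_mono)
      moreover have "j * (l - 1) \<le> card (A \<inter> {a<..2 ^ j * a})"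
        using card_between_power_two[OF double] a a1 assms(1) by simp
      ultimately have "j * (l - 1) \<le> counting_fun A x"
        by linarith
      then have "real j * (real l - 1) \<le> real (counting_fun A x)"
        using assms(1) by (metis One_nat_def Suc_1 Suc_leD of_nat_1 of_nat_diff of_nat_le_iff of_nat_mult)
      moreover have "(real l - 1) * (log 2 x - L - 1) < (real l - 1) * real j"
        using pos j(2) by simp
      ultimately show ?thesis
        unfolding eq by (simp add: mult.commute)
    next
      case False
      \<comment> \<open>For \<open>x\<close> below \<open>a\<close> no elements need to be found:
        the claimed lower bound is already negative.\<close>
      then have "log 2 x - L < 0"
        unfolding L_def using x by simp
      then have "(real l - 1) * (log 2 x - L - 1) < 0"
        using pos by (intro mult_pos_neg) auto
      then show ?thesis
        unfolding eq by linarith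
    qed
  qed
  ultimately show ?thesis
    by blast
qed

end
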